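(* Let $K$ be a finite graph and $L$ an induced subgraph. Let $S$ be a compact surface (possibly with boundary) and let $\Psi$ be a van Kampen diagram over $X_K$ on $S$ which is essential and such that every boundary edge of $S$ is labeled by a vertex of $L$. Let $D(S)$ be the surface obtained from $S$ and a copy $S'$ of $S$ by identifying each boundary component of $S$ with the corresponding boundary component of $S'$, and let $D(\Psi)$ be the map $D(S)\to X_K\cup_{X_L}X_K=X_{K*_LK}$ which is $\Psi$ on $S$ (into the first copy of $X_K$) and the copy of $\Psi$ on $S'$ (into the second copy). Then $D(\Psi)$ is faithful, i.e. the induced homomorphism $\pi_1(D(S),x)\to A(K*_LK)\cong A(K)*_{A(L)}A(K)$ (for a basepoint $x$ in $S$) is injective.
   Context: $A(K)$ is the right-angled Artin group of $K$. $X_K$ is its standard square complex (one vertex, one oriented edge labeled $a$ for each vertex $a$ of $K$, one square with boundary $aba^{-1}b^{-1}$ for each edge $\{a,b\}$ of $K$); $X_L\subseteq X_K$ is the subcomplex for $L$. The double $K*_LK$ is the graph obtained from two copies of $K$ by identifying them along $L$; $A(K*_LK)=A(K)*_{A(L)}A(K)$. A van Kampen diagram over $X_K$ on $S$ is a polygonal decomposition of $S$ together with a cellular map to $X_K$ (so edges carry labels in $K^0$ and each 2-cell is a square); it induces a homomorphism $\pi_1(S,x)\to A(K)$ ($x$ a vertex) by reading labels along edge loops, and it is faithful if this homomorphism is injective. For an edge path $\alpha$ with endpoints on $\partial S$, the word read along $\alpha$ represents an element $g$ of $A(K)$; its reduced content $\mathrm{rcont}(\alpha)$ is the smallest set $V$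 of vertices with $g\in A(V)=\langle V\rangle$. An essential arc is an arc with endpoints on $\partial S$ not homotopic relative to its endpoints into $\partial S$. $\Psi$ is essential if it is faithful and for every essential arc $\alpha$ with endpoints on $\partial S$, $\mathrm{rcont}(\alpha)\not\subseteq L^0$. *)

theory Defs
  imports Main
begin

text \<open>Combinatorial model. A polygonal (square) decomposition of a compact surface is
a finite 2-complex: vertices, oriented edges, and square 2-cells whose boundary is a
closed edge path of length 4 (a list of darts; (e,True) traverses e from src to tgt).\<close>

record ('v,'e,'f) cplx =
  verts :: "'v set"
  edges :: "'e set"
  faces :: "'f set"
  src :: "'e \<Rightarrow> 'v"
  tgt :: "'e \<Rightarrow> 'v"
  bnd :: "'f \<Rightarrow> ('e \<times> bool) list"

definition dstart :: "('v,'e,'f,'z) cplx_scheme \<Rightarrow> 'e \<times> bool \<Rightarrow> 'v" where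
  "dstart C d = (if snd d then src C (fst d) else tgt C (fst d))"

definition dend :: "('v,'e,'f,'z) cplx_scheme \<Rightarrow> 'e \<times> bool \<Rightarrow> 'v" where
  "dend C d = (if snd d then tgt C (fst d) else src C (fst d))"

definition dinv :: "'e \<times> bool \<Rightarrow> 'e \<times> bool" where
  "dinv d = (fst d, \<not> snd d)"

definition rev_path :: "('e \<times> bool) list \<Rightarrow> ('e \<times> bool) list" where
  "rev_path p = rev (map dinv p)"

text \<open>Edge paths from u to w.\<close>
fun is_path :: "('v,'e,'f,'z) cplx_scheme \<Rightarrow> 'v \<Rightarrow> ('e \<times> bool) list \<Rightarrow> 'v \<Rightarrow> bool" where
  "is_path C u [] w = (u \<in> verts C \<and> u = w)"
| "is_path C u (d # p) w = (fst d \<in> edges C \<and> dstart C d = u \<and> is_path C (dend C d) p w)"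

text \<open>Combinatorial homotopy of edge paths rel endpoints (edge-path groupoid):
generated by inserting/deleting backtracks and boundary loops of 2-cells.\<close>
definition face_loops :: "('v,'e,'f,'z) cplx_scheme \<Rightarrow> 'f \<Rightarrow> ('e \<times> bool) list set" where
  "face_loops C f = {rotate k (bnd C f) | k. True} \<union> {rotate k (rev_path (bnd C f)) | k. True}"

definition hstep :: "('v,'e,'f,'z) cplx_scheme \<Rightarrow> ('e \<times> bool) list \<Rightarrow> ('e \<times> bool) list \<Rightarrow> bool" where
  "hstep C p q \<longleftrightarrow>
     (\<exists>a b d. p = a @ d # dinv d # b \<and> q = a @ b) \<or>
     (\<exists>a b f r. f \<in> faces C \<and> r \<in> face_loops C f \<and> p = a @ b \<and> q = a @ r @ b)"

definition homotopic :: "('v,'e,'f,'z) cplx_scheme \<Rightarrow> 'v \<Rightarrow> ('e \<times> bool) list \<Rightarrow> ('e \<times> bool) list \<Rightarrow> 'v \<Rightarrow> bool" where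
  "homotopic C u p q w \<longleftrightarrow> is_path C u p w \<and>
     (p, q) \<in> {(p', q'). is_path C u p' w \<and> is_path C u q' w \<and> (hstep C p' q' \<or> hstep C q' p')}\<^sup>*"

definition cplx_wf :: "('v,'e,'f,'z) cplx_scheme \<Rightarrow> bool" where
  "cplx_wf C \<longleftrightarrow> finite (verts C) \<and> finite (edges C) \<and> finite (faces C) \<and>
     (\<forall>e\<in>edges C. src C e \<in> verts C \<and> tgt C e \<in> verts C) \<and>
     (\<forall>f\<in>faces C. length (bnd C f) = 4 \<and>
        is_path C (dstart C (hd (bnd C f))) (bnd C f) (dstart C (hd (bnd C f))))"

text \<open>Number of sides of 2-cells along which the edge e runs.\<close>
definition occ :: "('v,'e,'f,'z) cplx_scheme \<Rightarrow> 'e \<Rightarrow> nat" where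
  "occ C e = (\<Sum>f\<in>faces C. count_list (map fst (bnd C f)) e)"

text \<open>Link of a vertex: nodes are half-edges at v ((e,True) = the src-end of e),
link edges are corners of 2-cells.\<close>
definition halves :: "('v,'e,'f,'z) cplx_scheme \<Rightarrow> 'v \<Rightarrow> ('e \<times> bool) set" where
  "halves C v = {h. fst h \<in> edges C \<and> dstart C h = v}"

definition linkrel :: "('v,'e,'f,'z) cplx_scheme \<Rightarrow> (('e \<times> bool) \<times> ('e \<times> bool)) set" where
  "linkrel C = {(dinv (bnd C f ! i), bnd C f ! ((i + 1) mod 4)) | f i. f \<in> faces C \<and> i < 4}"

text \<open>Compact surface: every edge lies on one or two sides of 2-cells and every
vertex link is nonempty and connected (hence an arc or a circle).\<close>
definition surface :: "('v,'e,'f,'z) cplx_scheme \<Rightarrow> bool" where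
  "surface C \<longleftrightarrow> cplx_wf C \<and> (\<forall>e\<in>edges C. occ C e \<in> {1, 2}) \<and>
     (\<forall>v\<in>verts C. halves C v \<noteq> {} \<and>
        (\<forall>h1\<in>halves C v. \<forall>h2\<in>halves C v. (h1, h2) \<in> (linkrel C \<union> (linkrel C)\<inverse>)\<^sup>*))"

definition bd_edges :: "('v,'e,'f,'z) cplx_scheme \<Rightarrow> 'e set" where
  "bd_edges C = {e \<in> edges C. occ C e = 1}"

definition bd_verts :: "('v,'e,'f,'z) cplx_scheme \<Rightarrow> 'v set" where
  "bd_verts C = {v. \<exists>e\<in>bd_edges C. v = src C e \<or> v = tgt C e}"

text \<open>Finite simple graph (K0, EK); L is the induced subgraph on L0 \<subseteq> K0.\<close>
definition finite_graph :: "'k set \<Rightarrow> ('k \<Rightarrow> 'k \<Rightarrow> bool) \<Rightarrow> bool" where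
  "finite_graph K0 EK \<longleftrightarrow> finite K0 \<and>
     (\<forall>a b. EK a b \<longrightarrow> a \<in> K0 \<and> b \<in> K0 \<and> a \<noteq> b \<and> EK b a)"

text \<open>Right-angled Artin group A(K): words over generators and inverses
((a,True) = a, (a,False) = a^-1), modulo free cancellation and commutation of
adjacent letters a, b with {a,b} an edge of K.\<close>
definition rstep :: "('k \<Rightarrow> 'k \<Rightarrow> bool) \<Rightarrow> (('k \<times> bool) list \<times> ('k \<times> bool) list) set" where
  "rstep EK = {(a @ [(x, s), (x, \<not> s)] @ b, a @ b) | a b x s. True} \<union>
              {(a @ [(x, s), (y, t)] @ b, a @ [(y, t), (x, s)] @ b) | a b x y s t. EK x y}"

definition raag_eq :: "('k \<Rightarrow> 'k \<Rightarrow> bool) \<Rightarrow> ('k \<times> bool) list \<Rightarrow> ('k \<times> bool) list \<Rightarrow> bool" where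
  "raag_eq EK w w' \<longleftrightarrow> (w, w') \<in> (rstep EK \<union> (rstep EK)\<inverse>)\<^sup>*"

text \<open>w represents an element of A(V) = <V>.\<close>
definition in_parabolic :: "('k \<Rightarrow> 'k \<Rightarrow> bool) \<Rightarrow> 'k set \<Rightarrow> ('k \<times> bool) list \<Rightarrow> bool" where
  "in_parabolic EK V w \<longleftrightarrow> (\<exists>w'. fst ` set w' \<subseteq> V \<and> raag_eq EK w w')"

text \<open>Reduced content: the smallest V with g in A(V) (= the intersection of all such V).\<close>
definition rcont :: "'k set \<Rightarrow> ('k \<Rightarrow> 'k \<Rightarrow> bool) \<Rightarrow> ('k \<times> bool) list \<Rightarrow> 'k set" where
  "rcont K0 EK w = \<Inter> {V. V \<subseteq> K0 \<and> in_parabolic EK V w}"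

definition word :: "('e \<Rightarrow> 'k) \<Rightarrow> ('e \<times> bool) list \<Rightarrow> ('k \<times> bool) list" where
  "word lab p = map (\<lambda>(e, b). (lab e, b)) p"

text \<open>Van Kampen diagram over X_K on the surface C: edge labels in K^0 and every
2-cell is a square reading (a cyclic permutation of) a b a^-1 b^-1, {a,b} in K.\<close>
definition vk_diagram :: "'k set \<Rightarrow> ('k \<Rightarrow> 'k \<Rightarrow> bool) \<Rightarrow> ('v,'e,'f,'z) cplx_scheme \<Rightarrow> ('e \<Rightarrow> 'k) \<Rightarrow> bool" where
  "vk_diagram K0 EK C lab \<longleftrightarrow> surface C \<and> (\<forall>e\<in>edges C. lab e \<in> K0) \<and>
     (\<forall>f\<in>faces C. word lab (bnd C f) \<in>
        {rotate k [(a, True), (b, True), (a, False), (b, False)] | k a b. EK a b})"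

text \<open>Faithful: pi_1(S,x) -> A(K) injective for every vertex x.\<close>
definition faithful :: "('k \<Rightarrow> 'k \<Rightarrow> bool) \<Rightarrow> ('v,'e,'f,'z) cplx_scheme \<Rightarrow> ('e \<Rightarrow> 'k) \<Rightarrow> bool" where
  "faithful EK C lab \<longleftrightarrow> (\<forall>x\<in>verts C. \<forall>p q. is_path C x p x \<and> is_path C x q x \<and>
      raag_eq EK (word lab p) (word lab q) \<longrightarrow> homotopic C x p q x)"

text \<open>Essential arc: edge path between boundary vertices not homotopic rel endpoints
into the boundary subcomplex.\<close>
definition essential_arc :: "('v,'e,'f,'z) cplx_scheme \<Rightarrow> ('e \<times> bool) list \<Rightarrow> bool" where
  "essential_arc C p \<longleftrightarrow> (\<exists>u w. u \<in> bd_verts C \<and> w \<in> bd_verts C \<and> is_path C u p w \<and>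
      \<not> (\<exists>q. fst ` set q \<subseteq> bd_edges C \<and> homotopic C u p q w))"

definition essential :: "'k set \<Rightarrow> ('k \<Rightarrow> 'k \<Rightarrow> bool) \<Rightarrow> 'k set \<Rightarrow> ('v,'e,'f,'z) cplx_scheme \<Rightarrow> ('e \<Rightarrow> 'k) \<Rightarrow> bool" where
  "essential K0 EK L0 C lab \<longleftrightarrow> faithful EK C lab \<and>
     (\<forall>p. essential_arc C p \<longrightarrow> \<not> rcont K0 EK (word lab p) \<subseteq> L0)"

text \<open>The double K *_L K: vertices of L are shared, others come in two copies.\<close>
definition dblv :: "'k set \<Rightarrow> bool \<Rightarrow> 'k \<Rightarrow> 'k \<times> bool" where
  "dblv L0 c a = (a, if a \<in> L0 then False else c)"

definition dblE :: "('k \<Rightarrow> 'k \<Rightarrow> bool) \<Rightarrow> 'k set \<Rightarrow> 'k \<times> bool \<Rightarrow> 'k \<times> bool \<Rightarrow> bool" where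
  "dblE EK L0 x y \<longleftrightarrow> (\<exists>c a b. EK a b \<and> x = dblv L0 c a \<and> y = dblv L0 c b)"

text \<open>The double D(S): two copies of S glued by the identity along the boundary.\<close>
definition dsv :: "('v,'e,'f,'z) cplx_scheme \<Rightarrow> bool \<Rightarrow> 'v \<Rightarrow> 'v \<times> bool" where
  "dsv C c v = (v, if v \<in> bd_verts C then False else c)"

definition dse :: "('v,'e,'f,'z) cplx_scheme \<Rightarrow> bool \<Rightarrow> 'e \<Rightarrow> 'e \<times> bool" where
  "dse C c e = (e, if e \<in> bd_edges C then False else c)"

definition double :: "('v,'e,'f) cplx \<Rightarrow> ('v \<times> bool, 'e \<times> bool, 'f \<times> bool) cplx" where
  "double C = \<lparr> verts = {dsv C c v | c v. v \<in> verts C},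
                edges = {dse C c e | c e. e \<in> edges C},
                faces = {(f, c) | f c. f \<in> faces C},
                src = (\<lambda>(e, c). dsv C c (src C e)),
                tgt = (\<lambda>(e, c). dsv C c (tgt C e)),
                bnd = (\<lambda>(f, c). map (\<lambda>(e, b). (dse C c e, b)) (bnd C f)) \<rparr>"

text \<open>D(Psi): Psi on the copy c into the c-th copy of X_K.\<close>
definition dlab :: "'k set \<Rightarrow> ('e \<Rightarrow> 'k) \<Rightarrow> 'e \<times> bool \<Rightarrow> 'k \<times> bool" where
  "dlab L0 lab = (\<lambda>(e, c). dblv L0 c (lab e))"

end

theory Submission
  imports Defs
begin

text \<open>A loop in the double is cut at boundary vertices into edge paths of \<open>C\<close>, alternately in the
  two copies. If its word is trivial in \<open>A(K) *\<^bsub>A(L)\<^esub> A(K)\<close>, then by the normal form theorem one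
  of the pieces reads an element of \<open>A(L)\<close>. Essentiality makes this piece homotopic into the boundary,
  so it can be moved to the other copy and merged with its neighbours. This ends with a loop in a
  single copy, where faithfulness applies. The normal form theorem follows from the solution of the
  word problem: a nonempty trivial word contains \<open>x v x\<^sup>-\<^sup>1\<close> with every letter of \<open>v\<close> adjacent
  to \<open>x\<close>.\<close>

section \<open>Words in right-angled Artin groups\<close>

text \<open>The amalgam is treated as the right-angled Artin group of the double graph. The
  difficulty is to certify that a word is nontrivial: equality is generated by moves that may also
  lengthen words, so an invariant of the moves is needed, and for this letters are made to act on
  pilings. The algebraic induction carries the condition that no segment represents an element of
  \<open>A(L)\<close>. Unlike reducedness of the segments, it depends only on the elements
  represented and survives multiplication by elements of \<open>A(L)\<close> on either side. On the
  surface side, an essential arc is any suitable edge path, embedded or not, so pieces of an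
  arbitrary loop qualify as they are. The hypothesis on boundary labels ensures that a boundary edge
  reads the same letter of the double graph from both copies.\<close>

definition winv :: "('k \<times> bool) list \<Rightarrow> ('k \<times> bool) list" where
  "winv w = rev (map (\<lambda>(x, s). (x, \<not> s)) w)"

lemma raag_eq_refl [simp]: "raag_eq E w w"
  by (simp add: raag_eq_def)

lemma raag_eq_sym: "raag_eq E w w' \<Longrightarrow> raag_eq E w' w"
  unfolding raag_eq_def by (metis sym_Un_converse sym_rtrancl symD)

lemma raag_eq_trans [trans]: "raag_eq E u v \<Longrightarrow> raag_eq E v w \<Longrightarrow> raag_eq E u w"
  unfolding raag_eq_def by (rule rtrancl_trans)

text \<open>\<open>raag_eq\<close> is the least equivalence relation containing the two moves. Later
  invariance proofs reduce to checking one cancellation and one swap.\<close>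

lemma raag_eq_invariant:
  assumes "raag_eq E w w'"
    and cancel: "\<And>a b x s. R (a @ [(x, s), (x, \<not> s)] @ b) (a @ b)"
    and swap: "\<And>a b x y s t. E x y \<Longrightarrow> R (a @ [(x, s), (y, t)] @ b) (a @ [(y, t), (x, s)] @ b)"
    and refl: "\<And>a. R a a"
    and sym: "\<And>a b. R a b \<Longrightarrow> R b a"
    and trans: "\<And>a b c. R a b \<Longrightarrow> R b c \<Longrightarrow> R a c"
  shows "R w w'"
proof -
  have step: "R a b" if "(a, b) \<in> rstep E" for a b
    using that cancel swap unfolding rstep_def by blast
  from assms(1) have "(w, w') \<in> (rstep E \<union> (rstep E)\<inverse>)\<^sup>*" by (simp add: raag_eq_def)
  then show ?thesis
    by induction (use step refl sym trans in blast)+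
qed

lemma raag_eq_cancel: "raag_eq E (a @ (x, s) # (x, \<not> s) # b) (a @ b)"
proof -
  have "(a @ [(x, s), (x, \<not> s)] @ b, a @ b) \<in> rstep E" unfolding rstep_def by blast
  then show ?thesis unfolding raag_eq_def by auto
qed

lemma raag_eq_swap: "E x y \<Longrightarrow> raag_eq E (a @ (x, s) # (y, t) # b) (a @ (y, t) # (x, s) # b)"
proof -
  assume "E x y"
  then have "(a @ [(x, s), (y, t)] @ b, a @ [(y, t), (x, s)] @ b) \<in> rstep E"
    unfolding rstep_def by blast
  then show ?thesis unfolding raag_eq_def by auto
qed

lemma raag_eq_context:
  assumes "raag_eq E w w'"
  shows "raag_eq E (u @ w @ v) (u @ w' @ v)"
proof (rule raag_eq_invariant[OF assms, where R = "\<lambda>w w'. raag_eq E (u @ w @ v) (u @ w' @ v)"])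
  show "raag_eq E (u @ (a @ [(x, s), (x, \<not> s)] @ b) @ v) (u @ (a @ b) @ v)" for a b x s
    using raag_eq_cancel[of E "u @ a" x s "b @ v"] by simp
  show "raag_eq E (u @ (a @ [(x, s), (y, t)] @ b) @ v) (u @ (a @ [(y, t), (x, s)] @ b) @ v)"
    if "E x y" for a b x y s t
    using raag_eq_swap[of E x y "u @ a" s t "b @ v"] that by simp
qed (auto intro: raag_eq_sym raag_eq_trans)

lemma raag_eq_append:
  assumes "raag_eq E a a'" "raag_eq E b b'"
  shows "raag_eq E (a @ b) (a' @ b')"
  using raag_eq_trans raag_eq_context[OF assms(1), of "[]" b] raag_eq_context[OF assms(2), of a' "[]"]
  by fastforce

lemma raag_eq_map:
  assumes "raag_eq E w w'" and hom: "\<And>x y. E x y \<Longrightarrow> E' (h x) (h y)"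
  shows "raag_eq E' (map (apfst h) w) (map (apfst h) w')"
proof (rule raag_eq_invariant[OF assms(1),
      where R = "\<lambda>w w'. raag_eq E' (map (apfst h) w) (map (apfst h) w')"])
qed (auto intro: raag_eq_sym raag_eq_trans simp: raag_eq_cancel raag_eq_swap hom)

lemma raag_eq_winv_right: "raag_eq E (w @ winv w) []"
proof (induction w)
  case Nil
  then show ?case by (simp add: winv_def)
next
  case (Cons l w)
  obtain x s where l: "l = (x, s)" by fastforce
  have "raag_eq E ([(x, s)] @ (w @ winv w) @ [(x, \<not> s)]) ([(x, s)] @ [] @ [(x, \<not> s)])"
    by (rule raag_eq_context[OF Cons.IH])
  also have "raag_eq E \<dots> []" using raag_eq_cancel[of E "[]" x s "[]"] by simp
  finally show ?case by (simp add: winv_def l)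
qed

lemma raag_eq_winv_Nil:
  assumes "raag_eq E w []"
  shows "raag_eq E (winv w) []"
  using raag_eq_trans[OF raag_eq_sym raag_eq_winv_right] raag_eq_append[OF assms raag_eq_refl, of "winv w"]
  by fastforce

text \<open>Moving the first letter to the end is conjugation by it, which fixes the identity. This
  serves both the choice of a starting point on a 2-cell and the change of basepoint of a
  loop.\<close>

lemma raag_eq_rotate_Nil:
  assumes "raag_eq E w []"
  shows "raag_eq E (rotate k w) []"
proof (induction k)
  case 0
  then show ?case using assms by simp
next
  case (Suc k)
  show ?case
  proof (cases "rotate k w")
    case Nil
    then show ?thesis by simp
  next
    case (Cons l v)
    obtain x s where l: "l = (x, s)" by fastforce
    have "raag_eq E ([] @ (x, \<not> s) # (x, \<not> \<not> s) # (v @ [l])) (v @ [l])"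
      using raag_eq_cancel[of E "[]" x "\<not> s"] by simp
    then have "raag_eq E (v @ [l]) ([(x, \<not> s)] @ (l # v) @ [l])"
      by (simp add: l raag_eq_sym)
    also have "raag_eq E \<dots> ([(x, \<not> s)] @ [] @ [l])"
      by (rule raag_eq_context) (use Suc Cons in simp)
    also have "raag_eq E \<dots> []"
      using raag_eq_cancel[of E "[]" x "\<not> s" "[]"] by (simp add: l)
    finally show ?thesis using Cons by simp
  qed
qed

lemma raag_eq_commute_past:
  assumes "\<forall>l\<in>set v. E x (fst l)"
  shows "raag_eq E (u @ (x, s) # v @ z) (u @ v @ (x, s) # z)"
  using assms
proof (induction v arbitrary: u)
  case Nil
  then show ?case by simp
next
  case (Cons l v)
  obtain y t where l: "l = (y, t)" by fastforce
  have "raag_eq E (u @ (x, s) # (y, t) # v @ z) (u @ (y, t) # (x, s) # v @ z)"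
    by (rule raag_eq_swap) (use Cons.prems l in simp)
  also have "raag_eq E \<dots> (u @ (y, t) # v @ (x, s) # z)"
    using Cons.IH[of "u @ [(y, t)]"] Cons.prems by simp
  finally show ?case by (simp add: l)
qed

lemma raag_eq_cancel_past:
  assumes "\<forall>l\<in>set v. E x (fst l)"
  shows "raag_eq E (u @ (x, s) # v @ (x, \<not> s) # z) (u @ v @ z)"
proof -
  have "raag_eq E (u @ (x, s) # v @ (x, \<not> s) # z) (u @ v @ (x, s) # (x, \<not> s) # z)"
    by (rule raag_eq_commute_past) fact
  then show ?thesis using raag_eq_cancel[of E "u @ v" x s z] by (auto intro: raag_eq_trans)
qed

subsection \<open>Pilings\<close>

text \<open>Each generator owns a stack. A letter is recorded on its own stack and leaves a blank
  on the stack of every other generator with which it does not commute, so that the top of a stack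
  is a letter exactly if that letter can be moved to the end of the word.\<close>

definition push :: "('k \<Rightarrow> 'k \<Rightarrow> bool) \<Rightarrow> 'k \<times> bool \<Rightarrow> ('k \<Rightarrow> bool option list) \<Rightarrow> 'k \<Rightarrow> bool option list"
  where "push E l P = (\<lambda>y. if y = fst l then Some (snd l) # P y
                           else if E (fst l) y then P y else None # P y)"

text \<open>Undoes a \<open>push\<close> of \<open>x\<close>: the stack of \<open>x\<close> then
  starts with the letter, and the stacks of the other generators not commuting with \<open>x\<close>
  start with the blanks it left. On arbitrary stack families \<open>tl\<close> may destroy other
  entries.\<close>

definition pop :: "('k \<Rightarrow> 'k \<Rightarrow> bool) \<Rightarrow> 'k \<Rightarrow> ('k \<Rightarrow> bool option list) \<Rightarrow> 'k \<Rightarrow> bool option list"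
  where "pop E x P = (\<lambda>y. if E x y then P y else tl (P y))"

definition cancels :: "'k \<times> bool \<Rightarrow> ('k \<Rightarrow> bool option list) \<Rightarrow> bool"
  where "cancels l P \<longleftrightarrow> (\<exists>r. P (fst l) = Some (\<not> snd l) # r)"

definition pact :: "('k \<Rightarrow> 'k \<Rightarrow> bool) \<Rightarrow> 'k \<times> bool \<Rightarrow> ('k \<Rightarrow> bool option list) \<Rightarrow> 'k \<Rightarrow> bool option list"
  where "pact E l P = (if cancels l P then pop E (fst l) P else push E l P)"

text \<open>Restricting to families built by pushes that do not cancel makes the letters act
  invertibly; on an arbitrary family a \<open>pop\<close> need not be undone by a
  \<open>push\<close>.\<close>

inductive piling :: "('k \<Rightarrow> 'k \<Rightarrow> bool) \<Rightarrow> ('k \<Rightarrow> bool option list) \<Rightarrow> bool" for E where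
  empty: "piling E (\<lambda>_. [])"
| push: "piling E P \<Longrightarrow> \<not> cancels l P \<Longrightarrow> piling E (push E l P)"

definition pile :: "('k \<Rightarrow> 'k \<Rightarrow> bool) \<Rightarrow> ('k \<times> bool) list \<Rightarrow> 'k \<Rightarrow> bool option list" where
  "pile E w = fold (pact E) w (\<lambda>_. [])"

locale commutation_graph =
  fixes E :: "'k \<Rightarrow> 'k \<Rightarrow> bool"
  assumes sym: "E x y \<Longrightarrow> E y x" and irrefl: "\<not> E x x"
begin

lemma pop_push: "pop E x (push E (x, s) P) = P"
  using irrefl by (auto simp: pop_def push_def)

lemma push_commute: "E (fst l) (fst m) \<Longrightarrow> push E l (push E m P) = push E m (push E l P)"
  using irrefl sym by (fastforce simp: push_def)

text \<open>Every push after that of the visible letter commutes with \<open>x\<close>, since any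
  other would cover it with a blank or with a further letter of \<open>x\<close>. Hence
  \<open>push_commute\<close> makes it the last push.\<close>

lemma piling_top:
  assumes "piling E P" "P x = Some s # r"
  shows "\<exists>Q. piling E Q \<and> \<not> cancels (x, s) Q \<and> P = push E (x, s) Q"
  using assms
proof (induction arbitrary: r)
  case empty
  then show ?case by simp
next
  case (push P l)
  obtain y t where l: "l = (y, t)" by fastforce
  show ?case
  proof (cases "y = x")
    case True
    then show ?thesis using push l by (auto simp: push_def)
  next
    case False
    with push.prems l have E: "E y x" and "P x = Some s # r"
      by (auto simp: push_def split: if_splits)
    with push.IH obtain Q where Q: "piling E Q" "\<not> cancels (x, s) Q" "P = push E (x, s) Q"
      by blast
    have "\<not> cancels l Q" using push.hyps(2) Q(3) E sym False by (auto simp: cancels_def push_def l)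
    then have "piling E (push E l Q)" using Q(1) by (rule piling.push[rotated])
    moreover have "\<not> cancels (x, s) (push E l Q)"
      using Q(2) E False by (auto simp: cancels_def push_def l)
    moreover have "push E l P = push E (x, s) (push E l Q)"
      using push_commute E by (simp add: Q(3) l)
    ultimately show ?thesis by blast
  qed
qed

lemma cancels_obtain:
  assumes "piling E P" "cancels (x, s) P"
  obtains Q where "piling E Q" "\<not> cancels (x, \<not> s) Q" "P = push E (x, \<not> s) Q"
  using piling_top[OF assms(1), of x "\<not> s"] assms(2) by (auto simp: cancels_def)

lemma piling_pact: "piling E P \<Longrightarrow> piling E (pact E l P)"
proof (cases "cancels l P")
  case True
  assume "piling E P"
  with True cancels_obtain[of P "fst l" "snd l"] obtain Q
    where "piling E Q" "P = push E (fst l, \<not> snd l) Q" by auto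
  with True show ?thesis by (simp add: pact_def pop_push)
qed (simp add: pact_def piling.push)

lemma pact_inverse:
  assumes "piling E P"
  shows "pact E (x, \<not> s) (pact E (x, s) P) = P"
proof (cases "cancels (x, s) P")
  case True
  from cancels_obtain[OF assms True] obtain Q
    where "\<not> cancels (x, \<not> s) Q" "P = push E (x, \<not> s) Q" by auto
  with True show ?thesis by (simp add: pact_def pop_push)
next
  case False
  then have "cancels (x, \<not> s) (push E (x, s) P)" by (simp add: cancels_def push_def)
  with False show ?thesis by (simp add: pact_def pop_push)
qed

lemma pact_other: "E x y \<Longrightarrow> pact E (x, s) P y = P y"
  using irrefl by (auto simp: pact_def pop_def push_def)

lemma cancels_pact: "E x y \<Longrightarrow> cancels (y, t) (pact E (x, s) P) \<longleftrightarrow> cancels (y, t) P"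
  by (simp add: cancels_def pact_other)

lemma pop_push_commute:
  assumes "E x y"
  shows "pop E x (push E (y, t) (push E (x, s) Q)) = push E (y, t) (pop E x (push E (x, s) Q))"
  using push_commute[of "(y, t)" "(x, s)" Q] assms sym by (simp add: pop_push)

text \<open>Commuting letters do not touch each other's stacks, so neither affects whether the other
  cancels. In the mixed cases, on a stack commuting with neither letter, the two orders agree only
  because its top is a blank; writing \<open>P\<close> as a push exhibits that blank.\<close>

lemma pact_commute:
  assumes P: "piling E P" and E: "E x y"
  shows "pact E (x, s) (pact E (y, t) P) = pact E (y, t) (pact E (x, s) P)"
proof -
  have E': "E y x" using E sym by blast
  have 1: "cancels (x, s) (pact E (y, t) P) \<longleftrightarrow> cancels (x, s) P"
    and 2: "cancels (y, t) (pact E (x, s) P) \<longleftrightarrow> cancels (y, t) P"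
    using E E' by (auto simp: cancels_pact)
  show ?thesis
  proof (cases "cancels (x, s) P"; cases "cancels (y, t) P")
    assume "cancels (x, s) P" "cancels (y, t) P"
    then show ?thesis using 1 2 by (auto simp: pact_def pop_def)
  next
    assume c: "cancels (x, s) P" "\<not> cancels (y, t) P"
    obtain Q where "P = push E (x, \<not> s) Q" using cancels_obtain[OF P c(1)] by blast
    then show ?thesis using c 1 2 pop_push_commute[OF E] by (simp add: pact_def)
  next
    assume c: "\<not> cancels (x, s) P" "cancels (y, t) P"
    obtain Q where "P = push E (y, \<not> t) Q" using cancels_obtain[OF P c(2)] by blast
    then show ?thesis using c 1 2 pop_push_commute[OF E'] by (simp add: pact_def)
  next
    assume "\<not> cancels (x, s) P" "\<not> cancels (y, t) P"
    then show ?thesis using 1 2 push_commute[of "(x, s)" "(y, t)"] E by (simp add: pact_def)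
  qed
qed

lemma piling_pile: "piling E (pile E w)"
  by (induction w rule: rev_induct) (auto simp: pile_def piling.empty piling_pact)

lemma pile_append: "pile E (a @ b) = fold (pact E) b (pile E a)"
  by (simp add: pile_def)

text \<open>By \<open>pact_inverse\<close> and \<open>pact_commute\<close> the action of letters on
  pilings respects both moves, so the pile depends only on the element represented.\<close>

lemma pile_raag_eq:
  assumes "raag_eq E w w'"
  shows "pile E w = pile E w'"
  by (rule raag_eq_invariant[OF assms, where R = "\<lambda>w w'. pile E w = pile E w'"])
    (simp_all add: pile_append piling_pile pact_inverse pact_commute[OF piling_pile sym])

section \<open>Cancelling pairs in trivial words\<close>

definition cancellable :: "('k \<times> bool) list \<Rightarrow> bool" where
  "cancellable w \<longleftrightarrow> (\<exists>u x s v z. w = u @ (x, s) # v @ (x, \<not> s) # z \<and> (\<forall>l\<in>set v. E x (fst l)))"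

lemma cancellable_append: "cancellable w \<Longrightarrow> cancellable (w @ w')"
  unfolding cancellable_def by fastforce

text \<open>A letter that pops would complete a cancelling pair with the letter it meets. So every
  letter is pushed, and one still visible on its stack has been followed only by letters commuting
  with it.\<close>

lemma pile_top:
  assumes "\<not> cancellable w" "pile E w x = Some s # r"
  shows "\<exists>u v. w = u @ (x, s) # v \<and> (\<forall>l\<in>set v. E x (fst l))"
  using assms
proof (induction w arbitrary: x s r rule: rev_induct)
  case Nil
  then show ?case by (simp add: pile_def)
next
  case (snoc l w)
  have w: "\<not> cancellable w" using snoc.prems(1) cancellable_append by blast
  have "\<not> cancels l (pile E w)"
  proof
    assume "cancels l (pile E w)"
    then obtain r' where "pile E w (fst l) = Some (\<not> snd l) # r'" by (auto simp: cancels_def)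
    from snoc.IH[OF w this] obtain u v
      where "w = u @ (fst l, \<not> snd l) # v" "\<forall>m\<in>set v. E (fst l) (fst m)" by blast
    then have "w @ [l] = u @ (fst l, \<not> snd l) # v @ (fst l, \<not> \<not> snd l) # []" by simp
    then show False using snoc.prems(1) \<open>\<forall>m\<in>set v. _ m\<close> unfolding cancellable_def by blast
  qed
  then have pl: "pile E (w @ [l]) = push E l (pile E w)" by (simp add: pile_append pact_def)
  show ?case
  proof (cases "x = fst l")
    case True
    then have "w @ [l] = w @ (x, s) # []" using snoc.prems(2) pl by (cases l) (auto simp: push_def)
    then show ?thesis by fastforce
  next
    case False
    then have E: "E (fst l) x" and "pile E w x = Some s # r"
      using snoc.prems(2) pl by (auto simp: push_def split: if_splits)
    from snoc.IH[OF w this(2)] obtain u v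
      where "w = u @ (x, s) # v" "\<forall>m\<in>set v. E x (fst m)" by blast
    then have "w @ [l] = u @ (x, s) # (v @ [l])" "\<forall>m\<in>set (v @ [l]). E x (fst m)"
      using E sym by auto
    then show ?thesis by blast
  qed
qed

text \<open>The pile of a trivial word is empty, while a push leaves a nonempty stack. So the last
  letter pops, and by \<open>pile_top\<close> only commuting letters separate it from the inverse
  letter it meets, unless a pair occurs earlier.\<close>

lemma raag_eq_Nil_cancellable:
  assumes "raag_eq E w []" "w \<noteq> []"
  shows "cancellable w"
proof (rule ccontr)
  assume nc: "\<not> cancellable w"
  obtain w' l where w: "w = w' @ [l]" using assms(2) by (metis rev_exhaust)
  have pl: "pile E w = (\<lambda>_. [])" using pile_raag_eq[OF assms(1)] by (simp add: pile_def)
  have nc': "\<not> cancellable w'" using nc cancellable_append w by blast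
  have "cancels l (pile E w')"
  proof (rule ccontr)
    assume "\<not> cancels l (pile E w')"
    then have "pile E w (fst l) \<noteq> []" by (simp add: w pile_append pact_def push_def)
    then show False using pl by simp
  qed
  then obtain r' where "pile E w' (fst l) = Some (\<not> snd l) # r'" by (auto simp: cancels_def)
  from pile_top[OF nc' this] obtain u v
    where "w' = u @ (fst l, \<not> snd l) # v" "\<forall>m\<in>set v. E (fst l) (fst m)" by blast
  then have "w = u @ (fst l, \<not> snd l) # v @ (fst l, \<not> \<not> snd l) # []" by (simp add: w)
  then show False using nc \<open>\<forall>m\<in>set v. _ m\<close> unfolding cancellable_def by blast
qed

end

section \<open>Alternating products in the double\<close>

lemma in_parabolic_raag_eq:
  assumes "in_parabolic E V w" "raag_eq E w w'"
  shows "in_parabolic E V w'"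
  using assms raag_eq_trans raag_eq_sym unfolding in_parabolic_def by meson

lemma in_parabolic_self: "fst ` set w \<subseteq> V \<Longrightarrow> in_parabolic E V w"
  unfolding in_parabolic_def using raag_eq_refl by blast

lemma in_parabolic_append:
  assumes "in_parabolic E V u" "in_parabolic E V w"
  shows "in_parabolic E V (u @ w)"
proof -
  obtain u' w' where "fst ` set u' \<subseteq> V" "raag_eq E u u'" "fst ` set w' \<subseteq> V" "raag_eq E w w'"
    using assms unfolding in_parabolic_def by blast
  then have "fst ` set (u' @ w') \<subseteq> V" "raag_eq E (u @ w) (u' @ w')"
    by (auto intro: raag_eq_append)
  then show ?thesis unfolding in_parabolic_def by blast
qed

abbreviation inc :: "'k set \<Rightarrow> bool \<Rightarrow> ('k \<times> bool) list \<Rightarrow> (('k \<times> bool) \<times> bool) list" where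
  "inc L0 c w \<equiv> map (apfst (dblv L0 c)) w"

abbreviation dword :: "'k set \<Rightarrow> (bool \<times> ('k \<times> bool) list) list \<Rightarrow> (('k \<times> bool) \<times> bool) list" where
  "dword L0 segs \<equiv> concat (map (\<lambda>(c, w). inc L0 c w) segs)"

lemma fst_dblv [simp]: "fst (dblv L0 c a) = a"
  by (simp add: dblv_def)

lemma dblE_fst: "dblE E L0 x y \<Longrightarrow> E (fst x) (fst y)"
  by (auto simp: dblE_def)

lemma dblE_dblv: "E a b \<Longrightarrow> dblE E L0 (dblv L0 c a) (dblv L0 c b)"
  by (auto simp: dblE_def)

lemma raag_eq_inc: "raag_eq E w w' \<Longrightarrow> raag_eq (dblE E L0) (inc L0 c w) (inc L0 c w')"
  by (erule raag_eq_map) (rule dblE_dblv)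

text \<open>Forgetting the copy folds the double graph onto \<open>K\<close> and gives a left
  inverse of each inclusion of \<open>A(K)\<close>.\<close>

lemma raag_eq_inc_cancel:
  assumes "raag_eq (dblE E L0) (inc L0 c w) (inc L0 c w')"
  shows "raag_eq E w w'"
proof -
  have *: "map (apfst fst) (inc L0 c v) = v" for v :: "('a \<times> bool) list"
    by (induction v) auto
  show ?thesis using raag_eq_map[OF assms, of E fst] dblE_fst by (simp only: *) blast
qed

text \<open>The letter commutes past \<open>v\<close> to the end, where it is a factor from
  \<open>A(V)\<close>. Used contrapositively: deleting it from a word outside \<open>A(V)\<close>
  leaves a word outside \<open>A(V)\<close>.\<close>

lemma in_parabolic_remove_first:
  assumes "in_parabolic E V (u @ v)" "x \<in> V" "\<forall>l\<in>set v. E x (fst l)"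
  shows "in_parabolic E V (u @ (x, s) # v)"
proof -
  have "in_parabolic E V ((u @ v) @ [(x, s)])"
    by (rule in_parabolic_append[OF assms(1) in_parabolic_self]) (use assms(2) in simp)
  moreover have "raag_eq E (u @ (x, s) # v) (u @ v @ [(x, s)])"
    using assms(3) raag_eq_commute_past[of v E x u s "[]"] by simp
  ultimately show ?thesis using in_parabolic_raag_eq raag_eq_sym by fastforce
qed

lemma in_parabolic_remove_last:
  assumes "in_parabolic E V (v @ u)" "x \<in> V" "\<forall>l\<in>set v. E x (fst l)"
  shows "in_parabolic E V (v @ (x, s) # u)"
proof -
  have "in_parabolic E V ([(x, s)] @ (v @ u))"
    by (rule in_parabolic_append[OF in_parabolic_self assms(1)]) (use assms(2) in simp)
  moreover have "raag_eq E ((x, s) # v @ u) (v @ (x, s) # u)"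
    using assms(3) raag_eq_commute_past[of v E x "[]" s u] by simp
  ultimately show ?thesis using in_parabolic_raag_eq by fastforce
qed

text \<open>An edge of the double graph comes from a single copy of \<open>K\<close>, and outside
  \<open>L\<close> a vertex determines its copy.\<close>

lemma dblE_outside:
  assumes "dblE E L0 (dblv L0 c a) (dblv L0 d b)" "a \<notin> L0" "d \<noteq> c"
  shows "b \<in> L0"
  using assms by (auto simp: dblE_def dblv_def split: if_splits)

lemma append_eq_append_ConsD:
  assumes "a @ b = u @ l # z"
  shows "(\<exists>t. u = a @ t \<and> b = t @ l # z) \<or> (\<exists>t. a = u @ l # t \<and> z = t @ b)"
  using assms by (fastforce simp: append_eq_append_conv2 append_eq_Cons_conv)

lemma dword_split:
  assumes "dword L0 segs = u @ l # z"
  shows "\<exists>A c w1 a s w2 B. segs = A @ (c, w1 @ (a, s) # w2) # B \<and> l = (dblv L0 c a, s) \<and>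
     u = dword L0 A @ inc L0 c w1 \<and> z = inc L0 c w2 @ dword L0 B"
  using assms
proof (induction segs arbitrary: u)
  case Nil
  then show ?case by simp
next
  case (Cons seg segs)
  obtain c w where seg: "seg = (c, w)" by fastforce
  have eq: "inc L0 c w @ dword L0 segs = u @ l # z" using Cons.prems seg by simp
  consider t where "u = inc L0 c w @ t" "dword L0 segs = t @ l # z"
    | t where "inc L0 c w = u @ l # t" "z = t @ dword L0 segs"
    using append_eq_append_ConsD[OF eq] by blast
  then show ?case
  proof cases
    case 1
    from Cons.IH[OF 1(2)] obtain A c' w1 a s w2 B where
      "segs = A @ (c', w1 @ (a, s) # w2) # B" "l = (dblv L0 c' a, s)"
      "t = dword L0 A @ inc L0 c' w1" "z = inc L0 c' w2 @ dword L0 B" by blast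
    then have "seg # segs = (seg # A) @ (c', w1 @ (a, s) # w2) # B \<and> l = (dblv L0 c' a, s) \<and>
      u = dword L0 (seg # A) @ inc L0 c' w1 \<and> z = inc L0 c' w2 @ dword L0 B"
      using 1(1) seg by simp
    then show ?thesis by blast
  next
    case 2
    then obtain w1 m w2 where w: "w = w1 @ m # w2" "u = inc L0 c w1" "l = apfst (dblv L0 c) m"
      "t = inc L0 c w2"
      by (auto simp: map_eq_append_conv map_eq_Cons_conv)
    obtain a s where "m = (a, s)" by fastforce
    with w 2 seg have "seg # segs = [] @ (c, w1 @ (a, s) # w2) # segs \<and> l = (dblv L0 c a, s) \<and>
      u = dword L0 [] @ inc L0 c w1 \<and> z = inc L0 c w2 @ dword L0 segs" by simp
    then show ?thesis by blast
  qed
qed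

text \<open>Normal form theorem for \<open>A(K) *\<^bsub>A(L)\<^esub> A(K)\<close>. In a trivial word two inverse letters cancel.
  If they lie in different segments and outside \<open>L\<close>, then the segment of the other colour between
  them commutes with them and hence lies in \<open>A(L)\<close>; if they lie in \<open>L\<close>, deleting them
  changes the segments only by factors from \<open>A(L)\<close>.\<close>

lemma alternating_product_nontrivial:
  assumes graph: "commutation_graph (dblE E L0)"
    and "distinct_adj (map fst segs)" "segs \<noteq> []"
    and "\<forall>(c, w)\<in>set segs. \<not> in_parabolic E L0 w"
  shows "\<not> raag_eq (dblE E L0) (dword L0 segs) []"
  using assms(2-)
proof (induction "length (dword L0 segs)" arbitrary: segs rule: less_induct)
  case less
  interpret commutation_graph "dblE E L0" by (rule graph)
  show ?case
  proof
    assume triv: "raag_eq (dblE E L0) (dword L0 segs) []"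
    \<comment> \<open>The empty word lies in \<open>A(L)\<close>, so the hypothesis excludes empty
      segments and the whole word is nonempty.\<close>
    have nonempty: "w \<noteq> []" if "(c, w) \<in> set segs" for c w
      using that less.prems(3) in_parabolic_self[of "[]" L0 E] by auto
    obtain c0 w0 where "(c0, w0) \<in> set segs" using less.prems(2) by (cases segs) auto
    then have "dword L0 segs \<noteq> []" using nonempty by fastforce
    with triv obtain u X s v z where X: "dword L0 segs = u @ (X, s) # v @ (X, \<not> s) # z"
      and v: "\<forall>l\<in>set v. dblE E L0 X (fst l)"
      using raag_eq_Nil_cancellable unfolding cancellable_def by blast
    have triv': "raag_eq (dblE E L0) (u @ v @ z) []"
    proof -
      have "raag_eq (dblE E L0) (u @ (X, s) # v @ (X, \<not> s) # z) (u @ v @ z)"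
        by (rule raag_eq_cancel_past) fact
      then show ?thesis using triv X by (metis raag_eq_sym raag_eq_trans)
    qed
    have shorter: "length (u @ v @ z) < length (dword L0 segs)" by (simp add: X)
    from dword_split[OF X] obtain A c w1 a w2 B where
      segs: "segs = A @ (c, w1 @ (a, s) # w2) # B" and Xa: "X = dblv L0 c a"
      and u: "u = dword L0 A @ inc L0 c w1"
      and rest: "v @ (X, \<not> s) # z = inc L0 c w2 @ dword L0 B" by blast
    \<comment> \<open>Commutation with \<open>X\<close> in the double projects to commutation with
      \<open>a\<close> in \<open>K\<close>, whatever the copy of the segment.\<close>
    have adj: "\<forall>l\<in>set w. E a (fst l)" if "set (inc L0 d w) \<subseteq> set v" for d w
    proof
      fix l assume "l \<in> set w"
      then have "apfst (dblv L0 d) l \<in> set v" using that by auto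
      with v have "dblE E L0 X (dblv L0 d (fst l))" by fastforce
      from dblE_fst[OF this] show "E a (fst l)" by (simp add: Xa)
    qed
    consider (same) t where "inc L0 c w2 = v @ (X, \<not> s) # t" "z = t @ dword L0 B"
      | (other) t where "v = inc L0 c w2 @ t" "dword L0 B = t @ (X, \<not> s) # z"
      using append_eq_append_ConsD[OF rest[symmetric]] by blast
    then show False
    proof cases
      case same
      then obtain w3 w4 b where w2: "w2 = w3 @ (b, \<not> s) # w4" and v': "v = inc L0 c w3"
        and "X = dblv L0 c b" and t: "t = inc L0 c w4"
        by (auto simp: map_eq_append_conv map_eq_Cons_conv)
      then have b: "b = a" using Xa by (metis fst_dblv)
      have w3: "\<forall>l\<in>set w3. E a (fst l)" using adj[of c w3] v' by simp
      let ?segs = "A @ (c, w1 @ w3 @ w4) # B"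
      have dw: "dword L0 ?segs = u @ v @ z" by (simp add: u v' same(2) t)
      \<comment> \<open>Both letters lie in one segment, whose element of \<open>A(K)\<close> is
        unchanged by the deletion; so it stays outside \<open>A(L)\<close>.\<close>
      have "raag_eq E (w1 @ (a, s) # w2) (w1 @ w3 @ w4)"
        using w3 raag_eq_cancel_past[of w3 E a w1 s w4] by (simp add: w2 b)
      moreover have "\<not> in_parabolic E L0 (w1 @ (a, s) # w2)" using less.prems(3) segs by auto
      ultimately have "\<not> in_parabolic E L0 (w1 @ w3 @ w4)"
        using in_parabolic_raag_eq raag_eq_sym by blast
      then have "\<forall>(c, w)\<in>set ?segs. \<not> in_parabolic E L0 w" using less.prems(3) segs by auto
      moreover have "distinct_adj (map fst ?segs)" "?segs \<noteq> []" using less.prems(1) segs by simp_all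
      ultimately have "\<not> raag_eq (dblE E L0) (dword L0 ?segs) []"
        using less.hyps[of ?segs] shorter unfolding dw by blast
      then show False using triv' dw by simp
    next
      case other
      from dword_split[OF other(2)] obtain B1 c' w3 b w4 B2 where
        B: "B = B1 @ (c', w3 @ (b, \<not> s) # w4) # B2" and Xb: "X = dblv L0 c' b"
        and t: "t = dword L0 B1 @ inc L0 c' w3"
        and z: "z = inc L0 c' w4 @ dword L0 B2" by blast
      have b: "b = a" using Xa Xb by (metis fst_dblv)
      show False
      proof (cases "a \<in> L0")
        case True
        have w2: "\<forall>l\<in>set w2. E a (fst l)" using adj[of c w2] other(1) by simp
        have w3: "\<forall>l\<in>set w3. E a (fst l)" using adj[of c' w3] other(1) t by auto
        let ?segs = "A @ (c, w1 @ w2) # B1 @ (c', w3 @ w4) # B2"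
        have dw: "dword L0 ?segs = u @ v @ z" by (simp add: u other(1) t z)
        have "\<not> in_parabolic E L0 (w1 @ (a, s) # w2)" using less.prems(3) segs by auto
        then have 1: "\<not> in_parabolic E L0 (w1 @ w2)"
          using in_parabolic_remove_first[of E L0 w1 w2 a s] True w2 by blast
        have "\<not> in_parabolic E L0 (w3 @ (a, \<not> s) # w4)" using less.prems(3) segs B b by auto
        then have 2: "\<not> in_parabolic E L0 (w3 @ w4)"
          using in_parabolic_remove_last[of E L0 w3 w4 a "\<not> s"] True w3 by blast
        have "\<forall>(c, w)\<in>set ?segs. \<not> in_parabolic E L0 w" using less.prems(3) segs B 1 2 by auto
        moreover have "distinct_adj (map fst ?segs)" "?segs \<noteq> []"
          using less.prems(1) segs B by simp_all
        ultimately have "\<not> raag_eq (dblE E L0) (dword L0 ?segs) []"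
          using less.hyps[of ?segs] shorter unfolding dw by blast
        then show False using triv' dw by simp
      next
        case False
        \<comment> \<open>Outside \<open>L\<close> the letter determines its copy, so both segments
          have the same colour. Since neighbouring colours differ, a segment of the other colour
          follows the first one and lies entirely inside \<open>v\<close>.\<close>
        then have "c' = c" using Xa Xb b by (simp add: dblv_def)
        moreover have "distinct_adj (map fst ((c, w1 @ (a, s) # w2) # B))"
          using less.prems(1) segs by auto
        ultimately obtain d w5 B3 where B1: "B1 = (d, w5) # B3" and "d \<noteq> c"
          using B by (cases B1) auto
        have "fst l \<in> L0" if "l \<in> set w5" for l
        proof -
          have "apfst (dblv L0 d) l \<in> set v" using that other(1) t B1 by auto
          with v have "dblE E L0 X (fst (apfst (dblv L0 d) l))" by blast
          then have "dblE E L0 (dblv L0 c a) (dblv L0 d (fst l))" by (simp add: Xa)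
          from dblE_outside[OF this False \<open>d \<noteq> c\<close>] show ?thesis .
        qed
        then have "in_parabolic E L0 w5" by (intro in_parabolic_self) auto
        then show False using less.prems(3) segs B B1 by auto
      qed
    qed
  qed
qed

section \<open>Edge paths and homotopy\<close>

lemma is_path_start: "cplx_wf C \<Longrightarrow> is_path C u p w \<Longrightarrow> u \<in> verts C"
  by (cases p) (auto simp: cplx_wf_def dstart_def split: if_splits)

lemma is_path_end: "is_path C u p w \<Longrightarrow> w \<in> verts C"
  by (induction p arbitrary: u) auto

lemma is_path_append:
  assumes "cplx_wf C"
  shows "is_path C u (p @ q) w \<longleftrightarrow> (\<exists>v. is_path C u p v \<and> is_path C v q w)"
  by (induction p arbitrary: u) (auto dest: is_path_start[OF assms])

lemma dstart_dinv [simp]: "dstart C (dinv d) = dend C d"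
  and dend_dinv [simp]: "dend C (dinv d) = dstart C d"
  and fst_dinv [simp]: "fst (dinv d) = fst d"
  by (auto simp: dstart_def dend_def dinv_def)

lemma is_path_rev_path:
  assumes "cplx_wf C" "is_path C u p w"
  shows "is_path C w (rev_path p) u"
  using assms(2)
proof (induction p arbitrary: u)
  case Nil
  then show ?case by (auto simp: rev_path_def)
next
  case (Cons d p)
  then have "is_path C (dend C d) [dinv d] u"
    using is_path_start[OF assms(1) Cons.prems] by auto
  with Cons show ?case by (auto simp: rev_path_def is_path_append[OF assms(1)])
qed

lemma homotopic_refl: "is_path C u p w \<Longrightarrow> homotopic C u p p w"
  by (simp add: homotopic_def)

lemma homotopic_step:
  "is_path C u p w \<Longrightarrow> is_path C u q w \<Longrightarrow> hstep C p q \<Longrightarrow> homotopic C u p q w"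
  unfolding homotopic_def by blast

lemma homotopic_is_path:
  assumes "homotopic C u p q w"
  shows "is_path C u p w" "is_path C u q w"
proof -
  show p: "is_path C u p w" using assms by (simp add: homotopic_def)
  have "(p, q) \<in> {(p', q'). is_path C u p' w \<and> is_path C u q' w \<and> (hstep C p' q' \<or> hstep C q' p')}\<^sup>*"
    using assms by (simp add: homotopic_def)
  then show "is_path C u q w" by induction (auto simp: p)
qed

lemma homotopic_trans [trans]:
  "homotopic C u p q w \<Longrightarrow> homotopic C u q r w \<Longrightarrow> homotopic C u p r w"
  unfolding homotopic_def by (auto intro: rtrancl_trans)

lemma homotopic_sym:
  assumes "homotopic C u p q w"
  shows "homotopic C u q p w"
proof -
  let ?R = "{(p', q'). is_path C u p' w \<and> is_path C u q' w \<and> (hstep C p' q' \<or> hstep C q' p')}"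
  have "sym (?R\<^sup>*)" by (rule sym_rtrancl) (auto simp: sym_def)
  then show ?thesis
    using assms homotopic_is_path(2)[OF assms] unfolding homotopic_def by (blast dest: symD)
qed

lemma homotopic_invariant:
  assumes "homotopic C u p q w"
    and step: "\<And>p q. is_path C u p w \<Longrightarrow> is_path C u q w \<Longrightarrow> hstep C p q \<Longrightarrow> R p q"
    and refl: "\<And>p. is_path C u p w \<Longrightarrow> R p p"
    and sym: "\<And>a b. R a b \<Longrightarrow> R b a"
    and trans: "\<And>a b c. R a b \<Longrightarrow> R b c \<Longrightarrow> R a c"
  shows "R p q"
proof -
  have "(p, q) \<in> {(p', q'). is_path C u p' w \<and> is_path C u q' w \<and> (hstep C p' q' \<or> hstep C q' p')}\<^sup>*"
    using assms(1) by (simp add: homotopic_def)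
  then show ?thesis
  proof induction
    case base
    then show ?case using refl homotopic_is_path(1)[OF assms(1)] .
  next
    case (step a b)
    then show ?case using assms(2) sym trans by blast
  qed
qed

lemma hstep_context: "hstep C p q \<Longrightarrow> hstep C (a @ p @ b) (a @ q @ b)"
proof -
  assume "hstep C p q"
  then consider a' b' d where "p = a' @ d # dinv d # b'" "q = a' @ b'"
    | a' b' f r where "f \<in> faces C" "r \<in> face_loops C f" "p = a' @ b'" "q = a' @ r @ b'"
    unfolding hstep_def by blast
  then show ?thesis
  proof cases
    case 1
    then have "a @ p @ b = (a @ a') @ d # dinv d # (b' @ b)" "a @ q @ b = (a @ a') @ (b' @ b)"
      by simp_all
    then show ?thesis unfolding hstep_def by blast
  next
    case 2
    then have "a @ p @ b = (a @ a') @ (b' @ b)" "a @ q @ b = (a @ a') @ r @ (b' @ b)" by simp_all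
    then show ?thesis using 2 unfolding hstep_def by blast
  qed
qed

lemma homotopic_context:
  assumes wf: "cplx_wf C" and h: "homotopic C v p q v'"
    and a: "is_path C u a v" and b: "is_path C v' b w"
  shows "homotopic C u (a @ p @ b) (a @ q @ b) w"
proof -
  have path: "is_path C u (a @ r @ b) w" if "is_path C v r v'" for r
    using that a b by (auto simp: is_path_append[OF wf])
  show ?thesis
    by (rule homotopic_invariant[OF h, where R = "\<lambda>p q. homotopic C u (a @ p @ b) (a @ q @ b) w"])
      (auto intro: homotopic_step homotopic_refl homotopic_sym homotopic_trans path hstep_context)
qed

lemma homotopic_rev_path_right:
  assumes wf: "cplx_wf C" and "is_path C u p w"
  shows "homotopic C u (p @ rev_path p) [] u"
  using assms(2)
proof (induction p arbitrary: u)
  case Nil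
  then show ?case by (auto simp: rev_path_def intro: homotopic_refl)
next
  case (Cons d p)
  have u: "u \<in> verts C" using is_path_start[OF wf Cons.prems] .
  have p: "is_path C (dend C d) p w" using Cons.prems by simp
  have d: "is_path C u [d] (dend C d)" "is_path C (dend C d) [dinv d] u"
    using Cons.prems is_path_start[OF wf p] u by auto
  have "homotopic C u ([d] @ (p @ rev_path p) @ [dinv d]) ([d] @ [] @ [dinv d]) u"
    by (rule homotopic_context[OF wf Cons.IH[OF p] d])
  moreover have "homotopic C u ([d] @ [] @ [dinv d]) [] u"
  proof (rule homotopic_step)
    have "[d] @ [] @ [dinv d] = [] @ d # dinv d # []" by simp
    then show "hstep C ([d] @ [] @ [dinv d]) []" unfolding hstep_def by blast
  qed (use d u in auto)
  ultimately have "homotopic C u ([d] @ (p @ rev_path p) @ [dinv d]) [] u" by (rule homotopic_trans)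
  then show ?case by (simp add: rev_path_def)
qed

lemma word_append [simp]: "word lab (p @ q) = word lab p @ word lab q"
  by (simp add: word_def)

lemma word_rev_path: "word lab (rev_path p) = winv (word lab p)"
  by (simp add: word_def rev_path_def winv_def dinv_def rev_map case_prod_unfold)

lemma word_rotate: "word lab (rotate k p) = rotate k (word lab p)"
  by (simp add: word_def rotate_map)

text \<open>Backtracks read free cancellations, and face loops read rotations of a trivial word or
  of its inverse. Thus a piece of a loop may be replaced by a homotopic one without changing the
  element it reads.\<close>

lemma homotopic_raag_eq:
  assumes "homotopic C u p q w"
    and faces: "\<And>f. f \<in> faces C \<Longrightarrow> raag_eq E (word lab (bnd C f)) []"
  shows "raag_eq E (word lab p) (word lab q)"
proof (rule homotopic_invariant[OF assms(1), where R = "\<lambda>p q. raag_eq E (word lab p) (word lab q)"])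
  fix p q
  assume "hstep C p q"
  then consider a b d where "p = a @ d # dinv d # b" "q = a @ b"
    | a b f r where "f \<in> faces C" "r \<in> face_loops C f" "p = a @ b" "q = a @ r @ b"
    unfolding hstep_def by blast
  then show "raag_eq E (word lab p) (word lab q)"
  proof cases
    case 1
    then show ?thesis
      using raag_eq_cancel[of E "word lab a" "lab (fst d)" "snd d" "word lab b"]
      by (simp add: word_def dinv_def case_prod_unfold)
  next
    case 2
    have "raag_eq E (word lab r) []"
      using 2(2) raag_eq_rotate_Nil[OF faces[OF 2(1)]]
        raag_eq_rotate_Nil[OF raag_eq_winv_Nil[OF faces[OF 2(1)]]]
      by (auto simp: face_loops_def word_rotate word_rev_path)
    from raag_eq_context[OF this, of "word lab a" "word lab b"] show ?thesis
      by (simp add: 2 raag_eq_sym)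
  qed
qed (auto intro: raag_eq_sym raag_eq_trans)

section \<open>Paths in the double of a surface\<close>

definition lift :: "('v,'e,'f,'z) cplx_scheme \<Rightarrow> bool \<Rightarrow> ('e \<times> bool) list \<Rightarrow> (('e \<times> bool) \<times> bool) list"
  where "lift C c p = map (\<lambda>(e, b). (dse C c e, b)) p"

lemma lift_simps [simp]:
  "lift C c [] = []"
  "lift C c (d # p) = (dse C c (fst d), snd d) # lift C c p"
  "lift C c (p @ q) = lift C c p @ lift C c q"
  by (simp_all add: lift_def case_prod_unfold)

lemma bd_vertsI: "e \<in> bd_edges C \<Longrightarrow> src C e \<in> bd_verts C" "e \<in> bd_edges C \<Longrightarrow> tgt C e \<in> bd_verts C"
  by (auto simp: bd_verts_def)

lemma dsv_eq_iff: "dsv C c u = dsv C c' u' \<longleftrightarrow> u = u' \<and> (u \<in> bd_verts C \<or> c = c')"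
  by (auto simp: dsv_def)

lemma dsv_bd: "u \<in> bd_verts C \<Longrightarrow> dsv C c u = (u, False)"
  by (simp add: dsv_def)

text \<open>Both ends of a boundary edge are boundary vertices, so resetting the copy of the edge is
  consistent with resetting that of its ends.\<close>

lemma dstart_double: "dstart (double C) (dse C c e, b) = dsv C c (dstart C (e, b))"
  by (auto simp: dstart_def double_def dse_def dsv_def bd_vertsI)

lemma dend_double: "dend (double C) (dse C c e, b) = dsv C c (dend C (e, b))"
  by (auto simp: dend_def double_def dse_def dsv_def bd_vertsI)

lemma is_path_lift:
  "is_path C u p w \<Longrightarrow> is_path (double C) (dsv C c u) (lift C c p) (dsv C c w)"
proof (induction p arbitrary: u)
  case Nil
  then show ?case by (auto simp: double_def)
next
  case (Cons d p)
  then show ?case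
    by (cases d) (auto simp: dstart_double dend_double, auto simp: double_def)
qed

lemma cplx_wf_double:
  assumes "cplx_wf C"
  shows "cplx_wf (double C)"
proof -
  have V: "verts (double C) = (\<lambda>(c, v). dsv C c v) ` (UNIV \<times> verts C)"
    by (force simp: double_def)
  have Ed: "edges (double C) = (\<lambda>(c, e). dse C c e) ` (UNIV \<times> edges C)"
    by (force simp: double_def)
  have F: "faces (double C) = faces C \<times> UNIV" by (auto simp: double_def)
  have fin: "finite (verts (double C))" "finite (edges (double C))" "finite (faces (double C))"
    using assms unfolding V Ed F by (auto simp: cplx_wf_def)
  have ends: "src (double C) e \<in> verts (double C) \<and> tgt (double C) e \<in> verts (double C)"
    if "e \<in> edges (double C)" for e
    using that assms by (fastforce simp: double_def cplx_wf_def dse_def split: if_splits)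
  have faces: "length (bnd (double C) f) = 4 \<and> is_path (double C) (dstart (double C)
    (hd (bnd (double C) f))) (bnd (double C) f) (dstart (double C) (hd (bnd (double C) f)))"
    if f: "f \<in> faces (double C)" for f
  proof -
    obtain g c where g: "f = (g, c)" "g \<in> faces C" using f F by auto
    have b: "bnd (double C) f = lift C c (bnd C g)" by (simp add: g double_def lift_def)
    have len: "length (bnd C g) = 4"
      and p: "is_path C (dstart C (hd (bnd C g))) (bnd C g) (dstart C (hd (bnd C g)))"
      using assms g by (auto simp: cplx_wf_def)
    have "bnd C g \<noteq> []" using len by auto
    then obtain d r where "bnd C g = d # r" by (cases "bnd C g") auto
    then have "dstart (double C) (hd (bnd (double C) f)) = dsv C c (dstart C (hd (bnd C g)))"
      by (simp add: b dstart_double)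
    moreover have "length (lift C c (bnd C g)) = 4" using len by (simp add: lift_def)
    ultimately show ?thesis using is_path_lift[OF p] b by simp
  qed
  show ?thesis unfolding cplx_wf_def using fin ends faces by blast
qed

lemma lift_rev_path: "lift C c (rev_path p) = rev_path (lift C c p)"
  by (simp add: lift_def rev_path_def dinv_def rev_map case_prod_unfold)

lemma lift_rotate: "lift C c (rotate k p) = rotate k (lift C c p)"
  by (simp add: lift_def rotate_map)

lemma hstep_lift:
  assumes "hstep C p q"
  shows "hstep (double C) (lift C c p) (lift C c q)"
proof -
  consider a b d where "p = a @ d # dinv d # b" "q = a @ b"
    | a b f r where "f \<in> faces C" "r \<in> face_loops C f" "p = a @ b" "q = a @ r @ b"
    using assms unfolding hstep_def by blast
  then show ?thesis
  proof cases
    case 1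
    let ?d = "(dse C c (fst d), snd d)"
    have "lift C c p = lift C c a @ ?d # dinv ?d # lift C c b" "lift C c q = lift C c a @ lift C c b"
      using 1 by (simp_all add: dinv_def)
    then show ?thesis unfolding hstep_def by blast
  next
    case 2
    have bnd: "bnd (double C) (f, c) = lift C c (bnd C f)" by (simp add: double_def lift_def)
    have "(f, c) \<in> faces (double C)" using 2(1) by (simp add: double_def)
    moreover have "lift C c r \<in> face_loops (double C) (f, c)"
      using 2(2) by (auto simp: face_loops_def bnd lift_rotate lift_rev_path)
    moreover have "lift C c p = lift C c a @ lift C c b"
      "lift C c q = lift C c a @ lift C c r @ lift C c b"
      using 2 by simp_all
    ultimately show ?thesis unfolding hstep_def by blast
  qed
qed

lemma homotopic_lift:
  assumes "homotopic C u p q w"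
  shows "homotopic (double C) (dsv C c u) (lift C c p) (lift C c q) (dsv C c w)"
  by (rule homotopic_invariant[OF assms,
        where R = "\<lambda>p q. homotopic (double C) (dsv C c u) (lift C c p) (lift C c q) (dsv C c w)"])
    (auto intro: homotopic_step homotopic_refl homotopic_sym homotopic_trans is_path_lift hstep_lift)

text \<open>Consecutive edge paths of \<open>C\<close> between boundary vertices, each with the copy of \<open>C\<close>
  in the double that it is put in.\<close>

fun bsegs :: "('v,'e,'f,'z) cplx_scheme \<Rightarrow> 'v \<Rightarrow> (bool \<times> ('e \<times> bool) list) list \<Rightarrow> 'v \<Rightarrow> bool" where
  "bsegs C u [] w \<longleftrightarrow> u \<in> bd_verts C \<and> u = w"
| "bsegs C u ((c, p) # S) w \<longleftrightarrow> u \<in> bd_verts C \<and> (\<exists>v. is_path C u p v \<and> bsegs C v S w)"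

definition join :: "('v,'e,'f,'z) cplx_scheme \<Rightarrow> (bool \<times> ('e \<times> bool) list) list \<Rightarrow> (('e \<times> bool) \<times> bool) list"
  where "join C S = concat (map (\<lambda>(c, p). lift C c p) S)"

lemma join_simps [simp]:
  "join C [] = []" "join C ((c, p) # S) = lift C c p @ join C S" "join C (S @ T) = join C S @ join C T"
  by (simp_all add: join_def)

lemma bsegs_start: "bsegs C u S w \<Longrightarrow> u \<in> bd_verts C"
  by (cases S) auto

lemma bsegs_append: "bsegs C u (S @ T) w \<longleftrightarrow> (\<exists>v. bsegs C u S v \<and> bsegs C v T w)"
proof (induction S arbitrary: u)
  case Nil
  then show ?case by (auto dest: bsegs_start)
next
  case (Cons seg S)
  then show ?case by (cases seg) (simp, blast)
qed

lemma bd_verts_subset: "cplx_wf C \<Longrightarrow> v \<in> bd_verts C \<Longrightarrow> v \<in> verts C"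
  by (auto simp: cplx_wf_def bd_verts_def bd_edges_def)

lemma is_path_join:
  assumes "cplx_wf C" "bsegs C u S w"
  shows "is_path (double C) (u, False) (join C S) (w, False)"
  using assms(2)
proof (induction S arbitrary: u)
  case Nil
  then have "u = w" "u \<in> verts C" "(u, False) = dsv C False u"
    using bd_verts_subset[OF assms(1), of u] dsv_bd[of u C False] by auto
  then show ?case by (auto simp: double_def)
next
  case (Cons seg S)
  obtain c p where seg: "seg = (c, p)" by fastforce
  with Cons.prems obtain v where u: "u \<in> bd_verts C" and p: "is_path C u p v" and S: "bsegs C v S w"
    by auto
  have "is_path (double C) (u, False) (lift C c p) (v, False)"
    using is_path_lift[OF p, of c] dsv_bd[OF u] dsv_bd[OF bsegs_start[OF S]] by simp
  then show ?case using Cons.IH[OF S] by (auto simp: seg is_path_append[OF cplx_wf_double[OF assms(1)]])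
qed

text \<open>The copies meet only along the boundary, so the copy index can change only at a boundary
  vertex.\<close>

lemma double_edge_cases:
  assumes "is_path (double C) (dsv C c u) (d # p) y"
  obtains c' e b where "d = (dse C c' e, b)" "e \<in> edges C" "dstart C (e, b) = u"
    "u \<in> bd_verts C \<or> c' = c" "is_path (double C) (dsv C c' (dend C (e, b))) p y"
proof -
  obtain E b where d: "d = (E, b)" by fastforce
  with assms obtain c' e where E: "E = dse C c' e" "e \<in> edges C" by (auto simp: double_def)
  with assms d have "dsv C c' (dstart C (e, b)) = dsv C c u"
    and "is_path (double C) (dsv C c' (dend C (e, b))) p y"
    by (simp_all add: dstart_double dend_double)
  with that d E show ?thesis by (auto simp: dsv_eq_iff)
qed

text \<open>The initial piece \<open>p1\<close> is kept apart because \<open>u\<close> may be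
  interior. A cut is made only where the copy index changes; there the current vertex is on the
  boundary, the piece found so far becomes a segment, and \<open>p1\<close> restarts empty.\<close>

lemma double_path_to_boundary:
  assumes "cplx_wf C" "is_path (double C) (dsv C c u) p (w, False)" "w \<in> bd_verts C" "u \<in> verts C"
  shows "\<exists>p1 v S. is_path C u p1 v \<and> bsegs C v S w \<and> p = lift C c p1 @ join C S"
  using assms(2,4)
proof (induction p arbitrary: c u)
  case Nil
  then have "u = w" by (auto simp: dsv_def)
  then have "is_path C u [] u \<and> bsegs C u [] w \<and> [] = lift C c [] @ join C []"
    using Nil.prems(2) assms(3) by simp
  then show ?case by blast
next
  case (Cons d p)
  from double_edge_cases[OF Cons.prems(1)] obtain c' e b
    where d: "d = (dse C c' e, b)" and e: "e \<in> edges C" "dstart C (e, b) = u"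
      and c: "u \<in> bd_verts C \<or> c' = c"
      and p: "is_path (double C) (dsv C c' (dend C (e, b))) p (w, False)" .
  have "dend C (e, b) \<in> verts C" using assms(1) e(1) by (auto simp: cplx_wf_def dend_def)
  from Cons.IH[OF p this] obtain p1 v S where IH: "is_path C (dend C (e, b)) p1 v" "bsegs C v S w"
    "p = lift C c' p1 @ join C S" by blast
  have q: "is_path C u ((e, b) # p1) v" using IH e by simp
  show ?case
  proof (cases "c' = c")
    case True
    then have "d # p = lift C c ((e, b) # p1) @ join C S" using IH d by simp
    then show ?thesis using q IH by blast
  next
    case False
    then have "is_path C u [] u \<and> bsegs C u ((c', (e, b) # p1) # S) w \<and>
      d # p = lift C c [] @ join C ((c', (e, b) # p1) # S)"
      using c q IH d Cons.prems(2) by auto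
    then show ?thesis by blast
  qed
qed

text \<open>Supplies a boundary basepoint whenever the path is not simply a lift to one copy. For a
  surface without boundary only the first alternative can occur.\<close>

lemma double_path_cases:
  assumes wf: "cplx_wf C" and "is_path (double C) (dsv C c u) p y"
  shows "(\<exists>q w. is_path C u q w \<and> p = lift C c q \<and> y = dsv C c w) \<or>
    (\<exists>p1 p2 v. p = p1 @ p2 \<and> v \<in> bd_verts C \<and> is_path (double C) (dsv C c u) p1 (v, False) \<and>
       is_path (double C) (v, False) p2 y)" (is "?P c u p \<or> ?Q c u p")
  using assms(2)
proof (induction p arbitrary: c u)
  case Nil
  show ?case
  proof (cases "u \<in> bd_verts C")
    case True
    then have "[] = [] @ [] \<and> u \<in> bd_verts C \<and> is_path (double C) (dsv C c u) [] (u, False) \<and>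
       is_path (double C) (u, False) [] y" using Nil by (auto simp: dsv_bd)
    then show ?thesis by (intro disjI2 exI)
  next
    case False
    then have "u \<in> verts C" using Nil bd_verts_subset by (auto simp: double_def dsv_def split: if_splits)
    then have "is_path C u [] u \<and> [] = lift C c [] \<and> y = dsv C c u" using Nil by simp
    then show ?thesis by (intro disjI1 exI)
  qed
next
  case (Cons d p)
  from double_edge_cases[OF Cons.prems] obtain c' e b
    where d: "d = (dse C c' e, b)" and e: "e \<in> edges C" "dstart C (e, b) = u"
      and c: "u \<in> bd_verts C \<or> c' = c"
      and p: "is_path (double C) (dsv C c' (dend C (e, b))) p y" .
  show ?case
  proof (cases "u \<in> bd_verts C")
    case True
    then have "d # p = [] @ (d # p) \<and> u \<in> bd_verts C \<and> is_path (double C) (dsv C c u) [] (u, False) \<and>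
      is_path (double C) (u, False) (d # p) y"
      using Cons.prems is_path_start[OF cplx_wf_double[OF wf] Cons.prems] dsv_bd[OF True] by simp
    then show ?thesis by (intro disjI2 exI)
  next
    case False
    with c have c: "c' = c" by simp
    from Cons.IH[OF p] show ?thesis
    proof
      assume "?P c' (dend C (e, b)) p"
      then obtain q w where "is_path C (dend C (e, b)) q w" "p = lift C c q" "y = dsv C c w"
        using c by blast
      then have "is_path C u ((e, b) # q) w \<and> d # p = lift C c ((e, b) # q) \<and> y = dsv C c w"
        using e d c by simp
      then show ?thesis by (intro disjI1 exI)
    next
      assume "?Q c' (dend C (e, b)) p"
      then obtain p1 p2 v where "p = p1 @ p2" "v \<in> bd_verts C"
        "is_path (double C) (dsv C c (dend C (e, b))) p1 (v, False)" "is_path (double C) (v, False) p2 y"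
        using c by blast
      then have "d # p = (d # p1) @ p2 \<and> v \<in> bd_verts C \<and>
        is_path (double C) (dsv C c u) (d # p1) (v, False) \<and> is_path (double C) (v, False) p2 y"
        using Cons.prems d c by (simp add: dend_double)
      then show ?thesis by (intro disjI2 exI)
    qed
  qed
qed

lemma not_distinct_adj_split:
  assumes "\<not> distinct_adj (map fst S)"
  shows "\<exists>A c p q B. S = A @ (c, p) # (c, q) # B"
  using assms
proof (induction S rule: induct_list012)
  case (3 x y S)
  show ?case
  proof (cases "fst x = fst y")
    case True
    then have "x # y # S = [] @ (fst x, snd x) # (fst x, snd y) # S" by (cases x, cases y) simp
    then show ?thesis by blast
  next
    case False
    then have "\<not> distinct_adj (map fst (y # S))" using 3 by simp
    with 3 obtain A c p q B where "y # S = A @ (c, p) # (c, q) # B" by blast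
    then have "x # y # S = (x # A) @ (c, p) # (c, q) # B" by simp
    then show ?thesis by blast
  qed
qed simp_all

section \<open>Null-homotopic loops and faithfulness of the double\<close>

locale essential_diagram =
  fixes K0 :: "'k set" and EK :: "'k \<Rightarrow> 'k \<Rightarrow> bool" and L0 :: "'k set"
    and C :: "('v, 'e, 'f) cplx" and lab :: "'e \<Rightarrow> 'k"
  assumes graph: "finite_graph K0 EK"
    and L0: "L0 \<subseteq> K0"
    and diagram: "vk_diagram K0 EK C lab"
    and ess: "essential K0 EK L0 C lab"
    and bd_lab: "\<And>e. e \<in> bd_edges C \<Longrightarrow> lab e \<in> L0"
begin

lemma wf: "cplx_wf C"
  using diagram by (simp add: vk_diagram_def surface_def)

lemmas wf_double = cplx_wf_double[OF wf]

lemma commutation_graph_double: "commutation_graph (dblE EK L0)"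
proof
  show "dblE EK L0 y x" if "dblE EK L0 x y" for x y
    using that graph unfolding dblE_def finite_graph_def by blast
  show "\<not> dblE EK L0 x x" for x
    using graph dblE_fst[of EK L0 x x] unfolding finite_graph_def by blast
qed

lemma face_word_trivial:
  assumes "f \<in> faces C"
  shows "raag_eq EK (word lab (bnd C f)) []"
proof -
  obtain k a b where w: "word lab (bnd C f) = rotate k [(a, True), (b, True), (a, False), (b, False)]"
    and E: "EK a b"
    using diagram assms unfolding vk_diagram_def by blast
  have "raag_eq EK [(a, True), (b, True), (a, False), (b, False)] [(b, True), (b, False)]"
    using raag_eq_cancel_past[of "[(b, True)]" EK a "[]" True "[(b, False)]"] E by simp
  also have "raag_eq EK \<dots> []" using raag_eq_cancel[of EK "[]" b True "[]"] by simp
  finally show ?thesis unfolding w by (rule raag_eq_rotate_Nil)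
qed

text \<open>On a boundary edge \<open>dse\<close> resets the copy; the letter is unaffected because
  its label lies in \<open>L0\<close>, where \<open>dblv\<close> resets the copy too.\<close>

lemma word_lift: "word (dlab L0 lab) (lift C c p) = inc L0 c (word lab p)"
  using bd_lab by (auto simp: word_def lift_def dlab_def dse_def dblv_def)

lemma word_join: "word (dlab L0 lab) (join C S) = dword L0 (map (apsnd (word lab)) S)"
proof (induction S)
  case Nil
  then show ?case by (simp add: word_def)
next
  case (Cons seg S)
  then show ?case by (cases seg) (simp add: word_lift)
qed

text \<open>Folding the double graph gives triviality in \<open>A(K)\<close>, faithfulness of the
  original diagram gives a null-homotopy in \<open>C\<close>, and this lifts to copy
  \<open>c\<close>.\<close>

lemma lifted_loop_null:
  assumes p: "is_path C u p u" and "raag_eq (dblE EK L0) (word (dlab L0 lab) (lift C c p)) []"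
  shows "homotopic (double C) (dsv C c u) (lift C c p) [] (dsv C c u)"
proof -
  have "raag_eq (dblE EK L0) (inc L0 c (word lab p)) (inc L0 c (word lab []))"
    using assms(2) by (simp add: word_lift) (simp add: word_def)
  then have "raag_eq EK (word lab p) (word lab [])" by (rule raag_eq_inc_cancel)
  moreover have "is_path C u [] u" using is_path_end[OF p] by simp
  ultimately have "homotopic C u p [] u"
    using ess p is_path_end[OF p] unfolding essential_def faithful_def by blast
  from homotopic_lift[OF this, of c] show ?thesis by simp
qed

text \<open>\<open>L0\<close> is one of the sets intersected in \<open>rcont\<close>, so the reduced
  content lies in \<open>L0\<close> and the path cannot be an essential arc.\<close>

lemma parabolic_path_into_boundary:
  assumes "is_path C u p w" "u \<in> bd_verts C" "w \<in> bd_verts C" "in_parabolic EK L0 (word lab p)"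
  shows "\<exists>q. fst ` set q \<subseteq> bd_edges C \<and> homotopic C u p q w"
proof -
  have "rcont K0 EK (word lab p) \<subseteq> L0"
    using assms(4) L0 unfolding rcont_def by blast
  then have "\<not> essential_arc C p" using ess unfolding essential_def by blast
  then show ?thesis using assms(1-3) unfolding essential_arc_def by blast
qed

lemma lift_boundary_path: "fst ` set q \<subseteq> bd_edges C \<Longrightarrow> lift C c q = lift C c' q"
  by (auto simp: lift_def dse_def)

text \<open>Induction on the number of segments. Moving a segment to the other copy keeps this
  number and the merge it enables lowers it by one; hence \<open>merge\<close> is stated for every
  \<open>S'\<close> of the same length as \<open>S\<close>.\<close>

lemma segmented_loop_null:
  assumes "bsegs C u S u" "raag_eq (dblE EK L0) (word (dlab L0 lab) (join C S)) []"
  shows "homotopic (double C) (u, False) (join C S) [] (u, False)"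
  using assms
proof (induction "length S" arbitrary: S rule: less_induct)
  case less
  have merge: "homotopic (double C) (u, False) (join C S') [] (u, False)"
    if len: "length S' = length S" and nd: "\<not> distinct_adj (map fst S')" and segs: "bsegs C u S' u"
      and triv: "raag_eq (dblE EK L0) (word (dlab L0 lab) (join C S')) []" for S'
  proof -
    from not_distinct_adj_split[OF nd] obtain A c p q B where S': "S' = A @ (c, p) # (c, q) # B"
      by blast
    let ?S = "A @ (c, p @ q) # B"
    have j: "join C ?S = join C S'" by (simp add: S')
    have "bsegs C u ?S u" using segs by (auto simp: S' bsegs_append is_path_append[OF wf])
    then have "homotopic (double C) (u, False) (join C ?S) [] (u, False)"
      using less.hyps[of ?S] triv len by (simp only: j) (simp add: S')
    then show ?thesis by (simp only: j)
  qed
  show ?case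
  proof (cases "distinct_adj (map fst S)")
    case False
    then show ?thesis using merge less.prems by blast
  next
    case True
    show ?thesis
    proof (cases "length S \<le> 1")
      case short: True
      show ?thesis
      proof (cases S)
        case Nil
        then show ?thesis using is_path_join[OF wf less.prems(1)] by (auto intro: homotopic_refl)
      next
        case (Cons seg S1)
        then obtain c p where S: "S = [(c, p)]" using short by (cases seg) auto
        then have "is_path C u p u" "u \<in> bd_verts C" using less.prems(1) by auto
        then show ?thesis using lifted_loop_null[of u p c] less.prems(2) by (simp add: S dsv_bd)
      qed
    next
      case long: False
      have "\<exists>(c, w)\<in>set (map (apsnd (word lab)) S). in_parabolic EK L0 w"
      proof (rule ccontr)
        assume "\<not> ?thesis"
        then have "\<not> raag_eq (dblE EK L0) (dword L0 (map (apsnd (word lab)) S)) []"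
          using long True
          by (intro alternating_product_nontrivial[OF commutation_graph_double])
            (auto simp: comp_def)
        then show False using less.prems(2) by (simp add: word_join)
      qed
      then obtain c p where "(c, p) \<in> set S" and par: "in_parabolic EK L0 (word lab p)"
        by auto
      then obtain A B where S: "S = A @ (c, p) # B" by (meson split_list)
      from less.prems(1) obtain v v' where A: "bsegs C u A v" and v: "v \<in> bd_verts C"
        and p: "is_path C v p v'" and B: "bsegs C v' B u"
        by (auto simp: S bsegs_append)
      have v': "v' \<in> bd_verts C" using bsegs_start[OF B] .
      from parabolic_path_into_boundary[OF p v v' par] obtain q
        where q: "fst ` set q \<subseteq> bd_edges C" and hom: "homotopic C v p q v'" by blast
      \<comment> \<open>A boundary edge has only one lift, so \<open>q\<close> can be given the
        opposite colour and still denote the same path in the double.\<close>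
      let ?S = "A @ (\<not> c, q) # B"
      have lq: "lift C (\<not> c) q = lift C c q" using lift_boundary_path[OF q] .
      have "homotopic (double C) (v, False) (lift C c p) (lift C (\<not> c) q) (v', False)"
        using homotopic_lift[OF hom, of c] v v' by (simp add: dsv_bd lq)
      from homotopic_context[OF wf_double this is_path_join[OF wf A] is_path_join[OF wf B]]
      have hS: "homotopic (double C) (u, False) (join C S) (join C ?S) (u, False)"
        by (simp add: S)
      have segs: "bsegs C u ?S u"
        using A B v homotopic_is_path(2)[OF hom] by (auto simp: bsegs_append)
      have "raag_eq EK (word lab q) (word lab p)"
        using homotopic_raag_eq[OF homotopic_sym[OF hom] face_word_trivial] .
      from raag_eq_inc[OF this, of L0 c]
      have "raag_eq (dblE EK L0) (word (dlab L0 lab) (join C ?S)) (word (dlab L0 lab) (join C S))"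
        by (auto simp: S lq word_lift intro!: raag_eq_append)
      then have triv: "raag_eq (dblE EK L0) (word (dlab L0 lab) (join C ?S)) []"
        using less.prems(2) raag_eq_trans by blast
      \<comment> \<open>There are two colours and neighbours differed before, so the recoloured
        segment agrees with any neighbour. With at least two segments one exists: the predecessor
        serves if \<open>B\<close> is empty.\<close>
      have "\<not> distinct_adj (map fst ?S)"
      proof (cases B)
        case Nil
        with long S obtain A' s where "A = A' @ [s]" by (cases A rule: rev_cases) auto
        with True S show ?thesis by (auto simp: distinct_adj_append_iff)
      next
        case (Cons s B')
        with True S show ?thesis by (auto simp: distinct_adj_append_iff)
      qed
      then have "homotopic (double C) (u, False) (join C ?S) [] (u, False)"
        using merge[of ?S] segs triv by (simp add: S)
      with hS show ?thesis by (rule homotopic_trans)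
    qed
  qed
qed

lemma boundary_loop_null:
  assumes "v \<in> bd_verts C" "is_path (double C) (v, False) p (v, False)"
    and "raag_eq (dblE EK L0) (word (dlab L0 lab) p) []"
  shows "homotopic (double C) (v, False) p [] (v, False)"
proof -
  have "is_path (double C) (dsv C False v) p (v, False)" using assms by (simp add: dsv_bd)
  from double_path_to_boundary[OF wf this assms(1) bd_verts_subset[OF wf assms(1)]]
  obtain p1 v1 S where "is_path C v p1 v1" "bsegs C v1 S v" "p = lift C False p1 @ join C S"
    by blast
  then have "bsegs C v ((False, p1) # S) v" "p = join C ((False, p1) # S)" using assms(1) by auto
  then show ?thesis using segmented_loop_null assms(3) by blast
qed

lemma loop_null:
  assumes p: "is_path (double C) x p x"
    and triv: "raag_eq (dblE EK L0) (word (dlab L0 lab) p) []"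
  shows "homotopic (double C) x p [] x"
proof -
  have "x \<in> verts (double C)" using is_path_start[OF wf_double p] .
  then obtain c u where x: "x = dsv C c u" by (auto simp: double_def)
  from double_path_cases[OF wf p[unfolded x]] show ?thesis
  proof (elim disjE exE conjE)
    fix q w assume q: "is_path C u q w" "p = lift C c q" "dsv C c u = dsv C c w"
    then have "w = u" by (simp add: dsv_eq_iff)
    then show ?thesis using lifted_loop_null[of u q c] q(1) triv unfolding x q(2) by blast
  next
    fix a b v
    assume ab: "p = a @ b" and v: "v \<in> bd_verts C"
      and a: "is_path (double C) (dsv C c u) a (v, False)"
      and b: "is_path (double C) (v, False) b (dsv C c u)"
    let ?w = "word (dlab L0 lab)"
    \<comment> \<open>Moving the basepoint to \<open>v\<close> rotates the word cyclically, which
      preserves triviality.\<close>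
    have "rotate (length (?w a)) (?w p) = ?w (b @ a)" by (simp add: ab rotate_append)
    then have "raag_eq (dblE EK L0) (?w (b @ a)) []" using raag_eq_rotate_Nil[OF triv] by metis
    moreover have "is_path (double C) (v, False) (b @ a) (v, False)"
      using a b is_path_append[OF wf_double] by blast
    ultimately have ba: "homotopic (double C) (v, False) (b @ a) [] (v, False)"
      using boundary_loop_null v by blast
    have a': "is_path (double C) (v, False) (rev_path a) x"
      using is_path_rev_path[OF wf_double a] x by simp
    have ar: "homotopic (double C) x (a @ rev_path a) [] x"
      using homotopic_rev_path_right[OF wf_double a] x by simp
    have xx: "is_path (double C) x [] x" using \<open>x \<in> verts (double C)\<close> by simp
    \<comment> \<open>Appending \<open>a\<close> and its reverse turns \<open>a @ b\<close> into a
      conjugate of the loop \<open>b @ a\<close> at \<open>v\<close>, which is already known to be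
      null-homotopic.\<close>
    have "homotopic (double C) x (p @ [] @ []) (p @ (a @ rev_path a) @ []) x"
      by (rule homotopic_context[OF wf_double homotopic_sym[OF ar] p xx])
    then have "homotopic (double C) x p (a @ (b @ a) @ rev_path a) x" by (simp add: ab)
    also have "homotopic (double C) x (a @ (b @ a) @ rev_path a) (a @ [] @ rev_path a) x"
      by (rule homotopic_context[OF wf_double ba _ a']) (use a x in simp)
    also have "homotopic (double C) x (a @ [] @ rev_path a) [] x" using ar by simp
    finally show ?thesis .
  qed
qed

lemma faithful_double: "faithful (dblE EK L0) (double C) (dlab L0 lab)"
  unfolding faithful_def
proof (intro ballI allI impI, elim conjE)
  fix x p q
  assume x: "x \<in> verts (double C)" and p: "is_path (double C) x p x" and q: "is_path (double C) x q x"
    and eq: "raag_eq (dblE EK L0) (word (dlab L0 lab) p) (word (dlab L0 lab) q)"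
  have xx: "is_path (double C) x [] x" using x by simp
  have q': "is_path (double C) x (rev_path q) x" using is_path_rev_path[OF wf_double q] .
  let ?w = "word (dlab L0 lab)"
  have "raag_eq (dblE EK L0) (?w p @ winv (?w q)) (?w q @ winv (?w q))"
    by (rule raag_eq_append[OF eq raag_eq_refl])
  also have "raag_eq (dblE EK L0) \<dots> []" by (rule raag_eq_winv_right)
  finally have triv: "raag_eq (dblE EK L0) (?w (p @ rev_path q)) []" by (simp add: word_rev_path)
  have "is_path (double C) x (p @ rev_path q) x"
    using p q' is_path_append[OF wf_double] by blast
  from loop_null[OF this triv]
  have null: "homotopic (double C) x (p @ rev_path q) [] x" .
  have qq: "homotopic (double C) x (rev_path q @ q) [] x"
    using homotopic_rev_path_right[OF wf_double q'] by (simp add: rev_path_def dinv_def rev_map comp_def)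
  have "homotopic (double C) x (p @ [] @ []) (p @ (rev_path q @ q) @ []) x"
    by (rule homotopic_context[OF wf_double homotopic_sym[OF qq] p xx])
  then have "homotopic (double C) x p ([] @ (p @ rev_path q) @ q) x" by simp
  also have "homotopic (double C) x ([] @ (p @ rev_path q) @ q) ([] @ [] @ q) x"
    by (rule homotopic_context[OF wf_double null xx q])
  finally show "homotopic (double C) x p q x" by simp
qed

end

theorem theorem4p2:
  fixes K0 :: "'k set" and EK :: "'k \<Rightarrow> 'k \<Rightarrow> bool" and L0 :: "'k set"
    and C :: "('v, 'e, 'f) cplx" and lab :: "'e \<Rightarrow> 'k"
  assumes "finite_graph K0 EK"
    and "L0 \<subseteq> K0"
    and "vk_diagram K0 EK C lab"
    and "essential K0 EK L0 C lab"
    and "\<forall>e\<in>bd_edges C. lab e \<in> L0"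
  shows "faithful (dblE EK L0) (double C) (dlab L0 lab)"
proof -
  interpret essential_diagram K0 EK L0 C lab
    using assms by unfold_locales auto
  show ?thesis by (rule faithful_double)
qed

end
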